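(* Let $M$ be a connected manifold endowed with a pair of complementary foliations $\mathcal{H}$ (horizontal) and $\mathcal{V}$ (vertical). Consider $p\in M$ and $k\in\mathbb{N}$ such that the horizontal and vertical saturations commute in the sense that $$\mathcal{A}^k(p)=\underbrace{\mathcal{V}\circ\mathcal{H}\circ\cdots\circ\mathcal{V}\circ\mathcal{H}(p)}_{2k\text{ times}} .$$ Then $\mathcal{A}^k(p)=M$, i.e. the index of attainability is $I_A(p,\mathcal{H},\mathcal{V})=k$. In particular, in this case, $M=\mathcal{C}^{I_A(p,\mathcal{H},\mathcal{V})}(p)$.
   Context: Foliations $\mathcal{H}$ and $\mathcal{V}$ of $M$ are complementary if at each $x\in M$ the tangent space $T_xM$ is the direct sum of the tangent spaces of the leaves of $\mathcal{H}$ and $\mathcal{V}$ through $x$. For $S\subset M$, $\mathcal{H}(S)$ (resp. $\mathcal{V}(S)$) is the saturation of $S$: the union of all leaves of $\mathcal{H}$ (resp. $\mathcal{V}$) through points of $S$; for a point $x$, $\mathcal{H}(x)$ and $\mathcal{V}(x)$ are the leaves through $x$. The set of $k$-attainable points from $x\in M$ is obtained by $k$ steps of the pair of saturations $\mathcal{H}\circ\mathcal{V}$ (vertical saturation applied first): $$\mathcal{A}^k(x)=\underbrace{\mathcal{H}\circ\mathcal{V}\circ\cdots\circ\mathcal{H}\circ\mathcal{V}(x)}_{2k\text{ times}}.$$ The index of attainability at $x$ is the positive integer $I_A(x,\mathcal{H},\mathcal{V})=\min\{k\in\mathbb{N}:\mathcal{A}^k(x)=M\}$ when it exists, and $I_A(x,\mathcal{H},\mathcal{V})=\infty$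 otherwise. The $k$-co-attainable set of $x$ is $$\mathcal{C}^k(x)=\underbrace{\mathcal{H}\circ\mathcal{V}\circ\cdots\circ\mathcal{H}\circ\mathcal{V}(x)}_{2k\text{ times}}\cap\underbrace{\mathcal{V}\circ\mathcal{H}\circ\cdots\circ\mathcal{V}\circ\mathcal{H}(x)}_{2k\text{ times}}.$$
   Formalization: The claim I_A = k fails in general (product foliations of the plane, k = 2, index 1); proved instead: A^k(p) = M, C^k(p) = M, I_A ≤ k, with I_A = k if no smaller positive j has A^j(p) = M, and M = C^{I_A}(p) when I_A = k. *)

theory Defs
  imports "HOL-Analysis.Analysis" "HOL-Library.Extended_Nat"
begin

subsection \<open>Smooth maps and smooth manifolds\<close>

text \<open>Used on open sets only. Iterating directional derivatives in all directions \<open>v\<close> avoids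
  iterated spaces of linear maps.\<close>

primrec times_differentiable_on ::
  "nat \<Rightarrow> 'a::euclidean_space set \<Rightarrow> ('a \<Rightarrow> 'b::euclidean_space) \<Rightarrow> bool" where
  "times_differentiable_on 0 S f \<longleftrightarrow> continuous_on S f"
| "times_differentiable_on (Suc n) S f \<longleftrightarrow>
     (\<forall>x\<in>S. f differentiable (at x)) \<and>
     (\<forall>v. times_differentiable_on n S (\<lambda>x. frechet_derivative f (at x) v))"

definition smooth_on :: "'a::euclidean_space set \<Rightarrow> ('a \<Rightarrow> 'b::euclidean_space) \<Rightarrow> bool" where
  "smooth_on S f \<longleftrightarrow> (\<forall>n. times_differentiable_on n S f)"

text \<open>A chart is a pair of a domain and a coordinate map; the values of the coordinate map outside
  the domain are irrelevant.\<close>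

type_synonym ('m, 'e) chart = "'m set \<times> ('m \<Rightarrow> 'e)"

abbreviation dom_chart :: "('m, 'e) chart \<Rightarrow> 'm set" where
  "dom_chart c \<equiv> fst c"

abbreviation coord :: "('m, 'e) chart \<Rightarrow> 'm \<Rightarrow> 'e" where
  "coord c \<equiv> snd c"

definition inv_coord :: "('m, 'e) chart \<Rightarrow> 'e \<Rightarrow> 'm" where
  "inv_coord c = inv_into (dom_chart c) (coord c)"

definition is_chart :: "('m::topological_space, 'e::euclidean_space) chart \<Rightarrow> bool" where
  "is_chart c \<longleftrightarrow> open (dom_chart c) \<and> open (coord c ` dom_chart c) \<and>
     homeomorphism (dom_chart c) (coord c ` dom_chart c) (coord c) (inv_coord c)"

definition transition :: "('m, 'e) chart \<Rightarrow> ('m, 'e) chart \<Rightarrow> 'e \<Rightarrow> 'e" where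
  "transition c d = coord d \<circ> inv_coord c"

definition smoothly_compatible ::
  "('m::topological_space, 'e::euclidean_space) chart \<Rightarrow> ('m, 'e) chart \<Rightarrow> bool" where
  "smoothly_compatible c d \<longleftrightarrow>
     smooth_on (coord c ` (dom_chart c \<inter> dom_chart d)) (transition c d) \<and>
     smooth_on (coord d ` (dom_chart c \<inter> dom_chart d)) (transition d c)"

text \<open>The manifold is the whole type \<open>'m\<close>, of dimension \<open>DIM('e)\<close>. The Hausdorff
  and second countability axioms are the type classes of \<open>'m\<close>.\<close>

definition smooth_atlas ::
  "('m::{t2_space, second_countable_topology}, 'e::euclidean_space) chart set \<Rightarrow> bool" where
  "smooth_atlas A \<longleftrightarrow>
     (\<forall>c\<in>A. is_chart c) \<and> (\<Union>c\<in>A. dom_chart c) = UNIV \<and>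
     (\<forall>c\<in>A. \<forall>d\<in>A. smoothly_compatible c d)"

text \<open>A tangent vector at \<open>x\<close> is a family of coordinate vectors, one for each chart around \<open>x\<close>,
  that transforms by the derivatives of the transition maps. It is set to \<open>0\<close> on all other charts,
  so that equality of tangent vectors is equality of functions.\<close>

definition tangent_space ::
  "('m, 'e::euclidean_space) chart set \<Rightarrow> 'm \<Rightarrow> (('m, 'e) chart \<Rightarrow> 'e) set" where
  "tangent_space A x = {v.
     (\<forall>c\<in>A. \<forall>d\<in>A. x \<in> dom_chart c \<longrightarrow> x \<in> dom_chart d \<longrightarrow>
        v d = frechet_derivative (transition c d) (at (coord c x)) (v c)) \<and>
     (\<forall>c. \<not> (c \<in> A \<and> x \<in> dom_chart c) \<longrightarrow> v c = 0)}"


subsection \<open>Foliations\<close>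

text \<open>A foliation is given by an atlas of foliated charts onto open boxes. The coordinate
  directions in \<open>leaf_dirs\<close> are those tangent to the leaves; the remaining
  coordinates are transverse and are constant on plaques. The dimension of the leaves is
  \<open>card leaf_dirs\<close>.\<close>

record ('m, 'e) foliation =
  leaf_dirs :: "'e set"
  fol_charts :: "('m, 'e) chart set"

definition same_plaque ::
  "('m, 'e::euclidean_space) foliation \<Rightarrow> ('m, 'e) chart \<Rightarrow> 'm \<Rightarrow> 'm \<Rightarrow> bool" where
  "same_plaque F c y z \<longleftrightarrow> y \<in> dom_chart c \<and> z \<in> dom_chart c \<and>
     (\<forall>i \<in> Basis - leaf_dirs F. coord c y \<bullet> i = coord c z \<bullet> i)"

text \<open>The last conjunct says that transition maps between foliated charts have locally the form
  \<open>(u, w) \<mapsto> (h1 (u, w), h2 w)\<close>, where \<open>w\<close> are the transverse coordinates.\<close>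

definition is_foliation ::
  "('m::topological_space, 'e::euclidean_space) chart set \<Rightarrow> ('m, 'e) foliation \<Rightarrow> bool" where
  "is_foliation A F \<longleftrightarrow>
     leaf_dirs F \<subseteq> Basis \<and>
     (\<forall>c \<in> fol_charts F. is_chart c \<and> (\<exists>a b. coord c ` dom_chart c = box a b)) \<and>
     (\<Union>c \<in> fol_charts F. dom_chart c) = UNIV \<and>
     (\<forall>c \<in> fol_charts F. \<forall>d\<in>A. smoothly_compatible c d) \<and>
     (\<forall>c \<in> fol_charts F. \<forall>d \<in> fol_charts F. \<forall>x \<in> dom_chart c \<inter> dom_chart d.
        \<exists>W. open W \<and> x \<in> W \<and> W \<subseteq> dom_chart c \<inter> dom_chart d \<and>
            (\<forall>y\<in>W. \<forall>z\<in>W. same_plaque F c y z \<longrightarrow> same_plaque F d y z))"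

text \<open>Two points lie in the same leaf iff they are joined by a finite chain of plaques.\<close>

definition leaf :: "('m, 'e::euclidean_space) foliation \<Rightarrow> 'm \<Rightarrow> 'm set" where
  "leaf F x = {y. (\<lambda>u v. \<exists>c \<in> fol_charts F. same_plaque F c u v)\<^sup>*\<^sup>* x y}"

text \<open>The leaf coordinates of the foliated charts are the charts of the leaves, so the tangent space
  of the leaf through \<open>x\<close> consists of the vectors of \<open>T\<^sub>x M\<close> that, in a foliated chart
  around \<open>x\<close>, lie in the span of the leaf directions.\<close>

definition leaf_tangent_space ::
  "('m, 'e::euclidean_space) chart set \<Rightarrow> ('m, 'e) foliation \<Rightarrow> 'm \<Rightarrow> (('m, 'e) chart \<Rightarrow> 'e) set" where
  "leaf_tangent_space A F x = {v \<in> tangent_space A x.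
     \<exists>f \<in> fol_charts F. x \<in> dom_chart f \<and>
       (\<exists>w \<in> span (leaf_dirs F). \<forall>c\<in>A. x \<in> dom_chart c \<longrightarrow>
          v c = frechet_derivative (transition f c) (at (coord f x)) w)}"

definition complementary ::
  "('m, 'e::euclidean_space) chart set \<Rightarrow> ('m, 'e) foliation \<Rightarrow> ('m, 'e) foliation \<Rightarrow> bool" where
  "complementary A H V \<longleftrightarrow> (\<forall>x. \<forall>v \<in> tangent_space A x.
     \<exists>!(h, w). h \<in> leaf_tangent_space A H x \<and> w \<in> leaf_tangent_space A V x \<and>
               v = (\<lambda>c. h c + w c))"


subsection \<open>Attainability\<close>

definition saturation :: "('m, 'e::euclidean_space) foliation \<Rightarrow> 'm set \<Rightarrow> 'm set" where
  "saturation F S = (\<Union>x\<in>S. leaf F x)"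

definition attainable ::
  "('m, 'e::euclidean_space) foliation \<Rightarrow> ('m, 'e) foliation \<Rightarrow> nat \<Rightarrow> 'm \<Rightarrow> 'm set" where
  "attainable H V k x = ((saturation H \<circ> saturation V) ^^ k) {x}"

definition attainability_index ::
  "'m \<Rightarrow> ('m, 'e::euclidean_space) foliation \<Rightarrow> ('m, 'e) foliation \<Rightarrow> enat" where
  "attainability_index x H V =
     (if \<exists>k\<ge>1. attainable H V k x = UNIV
      then enat (LEAST k. k \<ge> 1 \<and> attainable H V k x = UNIV) else \<infinity>)"

definition co_attainable ::
  "('m, 'e::euclidean_space) foliation \<Rightarrow> ('m, 'e) foliation \<Rightarrow> nat \<Rightarrow> 'm \<Rightarrow> 'm set" where
  "co_attainable H V k x =
     ((saturation H \<circ> saturation V) ^^ k) {x} \<inter> ((saturation V \<circ> saturation H) ^^ k) {x}"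

end

theory Submission
  imports Defs
begin

text \<open>
  Put \<open>S = \<A>\<^sup>k(p)\<close>. As \<open>k \<ge> 1\<close>, the set \<open>S\<close> is by definition a horizontal saturation, and
  the commutation hypothesis exhibits it as a vertical saturation too. So both \<open>S\<close> and its
  complement are unions of leaves of \<open>\<H>\<close> and also unions of leaves of \<open>\<V>\<close>.

  Complementarity makes every such set open. Given a point \<open>x\<close>, move from it along its horizontal
  leaf, and from there along a vertical leaf. In coordinates this is a map \<open>\<Psi>\<close> of two parameters
  whose derivative at the origin has the range \<open>T\<^sub>x\<H> + T\<^sub>x\<V> = T\<^sub>xM\<close>. A map with a surjective
  derivative at one point covers a neighbourhood of the image of that point
  (\<open>sussmann_open_mapping\<close>), so \<open>\<V>(\<H>(x))\<close> is a neighbourhood of \<open>x\<close>: this is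
  \<open>complementary_saturation_nhd\<close>. Since \<open>M\<close> is connected and \<open>p \<in> S\<close>, it follows that \<open>S = M\<close>.

  The tangent space of a leaf is defined by means of some foliated chart, which may be a different
  one for each vector, whereas \<open>\<Psi>\<close> is written in one chart of each foliation.
  The two fit together because derivatives of the transition maps between foliated charts
  preserve the span of the leaf directions (\<open>foliated_transition_deriv_in_span\<close>).
\<close>

section \<open>Saturations\<close>

lemma leaf_refl: "x \<in> leaf F x"
  by (simp add: leaf_def)

lemma leaf_trans: "y \<in> leaf F x \<Longrightarrow> z \<in> leaf F y \<Longrightarrow> z \<in> leaf F x"
  unfolding leaf_def by (auto intro: rtranclp_trans)

lemma leaf_sym: "y \<in> leaf F x \<Longrightarrow> x \<in> leaf F y"
proof -
  assume y: "y \<in> leaf F x"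
  let ?R = "\<lambda>u v. \<exists>c \<in> fol_charts F. same_plaque F c u v"
  have "symp ?R"
    by (rule sympI) (auto simp: same_plaque_def)
  with y show ?thesis
    unfolding leaf_def by (simp add: symp_rtranclp sympD)
qed

lemma same_plaque_imp_leaf: "c \<in> fol_charts F \<Longrightarrow> same_plaque F c x y \<Longrightarrow> y \<in> leaf F x"
  unfolding leaf_def by blast

lemma saturation_superset: "S \<subseteq> saturation F S"
  by (auto simp: saturation_def leaf_refl)

lemma saturation_idem: "saturation F (saturation F S) = saturation F S"
proof
  show "saturation F (saturation F S) \<subseteq> saturation F S"
  proof
    fix z assume "z \<in> saturation F (saturation F S)"
    then obtain x y where "x \<in> S" "y \<in> leaf F x" "z \<in> leaf F y"
      unfolding saturation_def by blast
    then show "z \<in> saturation F S"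
      unfolding saturation_def using leaf_trans[of y F x z] by blast
  qed
qed (rule saturation_superset)

lemma saturation_Compl:
  assumes "saturation F S = S"
  shows "saturation F (- S) = - S"
proof
  show "saturation F (- S) \<subseteq> - S"
  proof
    fix y assume "y \<in> saturation F (- S)"
    then obtain x where x: "x \<notin> S" "y \<in> leaf F x"
      unfolding saturation_def by blast
    have "x \<in> S" if "y \<in> S"
      using leaf_sym[OF x(2)] that assms unfolding saturation_def by blast
    with x(1) show "y \<in> - S"
      by blast
  qed
qed (rule saturation_superset)

lemma saturation_mono: "S \<subseteq> T \<Longrightarrow> saturation F S \<subseteq> saturation F T"
  unfolding saturation_def by blast

lemma saturations_pow_superset: "S \<subseteq> ((saturation F \<circ> saturation G) ^^ k) S"
proof (induction k)
  case (Suc k)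
  also have "((saturation F \<circ> saturation G) ^^ k) S
      \<subseteq> saturation G (((saturation F \<circ> saturation G) ^^ k) S)"
    by (rule saturation_superset)
  also have "\<dots> \<subseteq> saturation F (saturation G (((saturation F \<circ> saturation G) ^^ k) S))"
    by (rule saturation_superset)
  finally show ?case
    by (simp add: o_def)
qed simp

lemma saturation_saturations_pow:
  assumes "k \<ge> 1"
  shows "saturation F (((saturation F \<circ> saturation G) ^^ k) S)
    = ((saturation F \<circ> saturation G) ^^ k) S"
proof -
  from assms obtain j where "k = Suc j"
    by (cases k) auto
  then show ?thesis
    by (simp add: saturation_idem)
qed

section \<open>Charts and the derivatives of their transition maps\<close>

lemma inv_coord_coord: "is_chart c \<Longrightarrow> x \<in> dom_chart c \<Longrightarrow> inv_coord c (coord c x) = x"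
  unfolding is_chart_def homeomorphism_def by blast

lemma open_coord_image:
  assumes "is_chart c" "open W" "W \<subseteq> dom_chart c"
  shows "open (coord c ` W)"
proof -
  have hom: "homeomorphism (dom_chart c) (coord c ` dom_chart c) (coord c) (inv_coord c)"
    and opn: "open (coord c ` dom_chart c)"
    using assms by (auto simp: is_chart_def)
  have "openin (top_of_set (dom_chart c)) W"
    using assms open_subset by blast
  then show ?thesis
    using homeomorphism_imp_open_map[OF hom] opn openin_open_trans by blast
qed

lemma transition_coord:
  "is_chart c \<Longrightarrow> x \<in> dom_chart c \<Longrightarrow> transition c d (coord c x) = coord d x"
  by (simp add: transition_def inv_coord_coord)

lemma continuous_on_transition:
  assumes "is_chart c" "is_chart d"
  shows "continuous_on (coord c ` (dom_chart c \<inter> dom_chart d)) (transition c d)"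
  unfolding transition_def
proof (rule continuous_on_compose)
  show "continuous_on (coord c ` (dom_chart c \<inter> dom_chart d)) (inv_coord c)"
    using assms(1) unfolding is_chart_def homeomorphism_def
    by (meson continuous_on_subset image_mono inf_le1)
  have "inv_coord c ` coord c ` (dom_chart c \<inter> dom_chart d) \<subseteq> dom_chart d"
    using assms(1) by (auto simp: inv_coord_coord)
  then show "continuous_on (inv_coord c ` coord c ` (dom_chart c \<inter> dom_chart d)) (coord d)"
    using assms(2) unfolding is_chart_def homeomorphism_def
    by (meson continuous_on_subset)
qed

definition diff_transition_at :: "('m, 'e::euclidean_space) chart \<Rightarrow> ('m, 'e) chart \<Rightarrow> 'm \<Rightarrow> bool"
  where "diff_transition_at c d x \<longleftrightarrow> transition c d differentiable (at (coord c x))"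

abbreviation transition_deriv ::
  "('m, 'e::euclidean_space) chart \<Rightarrow> ('m, 'e) chart \<Rightarrow> 'm \<Rightarrow> 'e \<Rightarrow> 'e"
  where "transition_deriv c d x \<equiv> frechet_derivative (transition c d) (at (coord c x))"

lemma atlas_chart: "smooth_atlas A \<Longrightarrow> c \<in> A \<Longrightarrow> is_chart c"
  by (simp add: smooth_atlas_def)

lemma atlas_compatible:
  "smooth_atlas A \<Longrightarrow> c \<in> A \<Longrightarrow> d \<in> A \<Longrightarrow> smoothly_compatible c d"
  by (simp add: smooth_atlas_def)

lemma foliation_chart: "is_foliation A F \<Longrightarrow> c \<in> fol_charts F \<Longrightarrow> is_chart c"
  by (simp add: is_foliation_def)

lemma foliation_compatible:
  "is_foliation A F \<Longrightarrow> c \<in> fol_charts F \<Longrightarrow> d \<in> A \<Longrightarrow> smoothly_compatible c d"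
  by (simp add: is_foliation_def)

lemma transition_has_derivative:
  "diff_transition_at c d x \<Longrightarrow>
    (transition c d has_derivative transition_deriv c d x) (at (coord c x))"
  by (simp add: diff_transition_at_def flip: frechet_derivative_works)

lemma smoothly_compatible_diff:
  assumes "smoothly_compatible c d" "x \<in> dom_chart c" "x \<in> dom_chart d"
  shows "diff_transition_at c d x" "diff_transition_at d c x"
proof -
  have "times_differentiable_on (Suc 0) (coord c ` (dom_chart c \<inter> dom_chart d)) (transition c d)"
    "times_differentiable_on (Suc 0) (coord d ` (dom_chart c \<inter> dom_chart d)) (transition d c)"
    using assms(1) unfolding smoothly_compatible_def smooth_on_def by blast+
  then show "diff_transition_at c d x" "diff_transition_at d c x"
    using assms(2,3) by (auto simp: diff_transition_at_def)
qed

lemma transition_has_derivative_comp: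
  assumes charts: "is_chart c" "is_chart d" "is_chart e"
    and x: "x \<in> dom_chart c" "x \<in> dom_chart d" "x \<in> dom_chart e"
    and diff: "diff_transition_at c d x" "diff_transition_at d e x"
  shows "(transition c e has_derivative (transition_deriv d e x \<circ> transition_deriv c d x))
    (at (coord c x))"
proof -
  let ?W = "dom_chart c \<inter> dom_chart d"
  have "open ?W"
    using charts by (auto simp: is_chart_def)
  then have W: "open (coord c ` ?W)"
    using charts by (intro open_coord_image) auto
  have d1: "(transition c d has_derivative transition_deriv c d x) (at (coord c x))"
    using diff(1) by (rule transition_has_derivative)
  have d2: "(transition d e has_derivative transition_deriv d e x)
      (at (transition c d (coord c x)))"
    using transition_has_derivative[OF diff(2)] charts x by (simp add: transition_coord)
  have "((transition d e \<circ> transition c d) has_derivative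
      (transition_deriv d e x \<circ> transition_deriv c d x)) (at (coord c x))"
    by (rule diff_chain_at[OF d1 d2])
  then show ?thesis
  proof (rule has_derivative_transform_within_open[OF _ W])
    show "coord c x \<in> coord c ` ?W"
      using x by blast
    show "\<And>z. z \<in> coord c ` ?W \<Longrightarrow> (transition d e \<circ> transition c d) z = transition c e z"
      using charts by (auto simp: transition_coord)
  qed
qed

lemma diff_transition_at_trans:
  assumes "is_chart c" "is_chart d" "is_chart e"
    and "x \<in> dom_chart c" "x \<in> dom_chart d" "x \<in> dom_chart e"
    and "diff_transition_at c d x" "diff_transition_at d e x"
  shows "diff_transition_at c e x"
  using transition_has_derivative_comp[OF assms]
  unfolding diff_transition_at_def differentiable_def by blast

lemma transition_deriv_comp:
  assumes "is_chart c" "is_chart d" "is_chart e"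
    and "x \<in> dom_chart c" "x \<in> dom_chart d" "x \<in> dom_chart e"
    and "diff_transition_at c d x" "diff_transition_at d e x"
  shows "transition_deriv d e x (transition_deriv c d x v) = transition_deriv c e x v"
  using frechet_derivative_at[OF transition_has_derivative_comp[OF assms]]
  by (metis comp_apply)

lemma transition_deriv_self:
  assumes "is_chart c" "x \<in> dom_chart c"
  shows "transition_deriv c c x v = v"
proof -
  have "((\<lambda>z. z) has_derivative (\<lambda>h. h)) (at (coord c x))"
    by (rule has_derivative_ident)
  then have "(transition c c has_derivative (\<lambda>h. h)) (at (coord c x))"
  proof (rule has_derivative_transform_within_open)
    show "open (coord c ` dom_chart c)"
      using assms by (simp add: is_chart_def)
    show "coord c x \<in> coord c ` dom_chart c"
      using assms by blast
    show "\<And>z. z \<in> coord c ` dom_chart c \<Longrightarrow> z = transition c c z"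
      using assms by (auto simp: transition_coord)
  qed
  from frechet_derivative_at[OF this] show ?thesis
    by metis
qed

text \<open>Two charts that are compatible with an atlas are differentiably compatible with each other,
  since near each point their transition map factors through a chart of the atlas.\<close>

lemma diff_transition_at_via_atlas:
  assumes "smooth_atlas A" "is_chart f" "is_chart g"
    and "\<forall>d\<in>A. smoothly_compatible f d" "\<forall>d\<in>A. smoothly_compatible g d"
    and "x \<in> dom_chart f" "x \<in> dom_chart g"
  shows "diff_transition_at f g x"
proof -
  from assms(1) obtain c where "c \<in> A" "x \<in> dom_chart c" "is_chart c"
    unfolding smooth_atlas_def by blast
  then show ?thesis
    using assms diff_transition_at_trans smoothly_compatible_diff by metis
qed

section \<open>Leaf directions in foliated charts\<close>

text \<open>The derivative can be computed on a line in a leaf direction. Such a line stays in one plaque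
  of \<open>f\<close>, hence near \<open>x\<close> in one plaque of \<open>f'\<close>, so its transverse coordinates in \<open>f'\<close> are
  constant.\<close>

lemma foliated_transition_deriv_in_span:
  fixes F :: "('m::topological_space, 'e::euclidean_space) foliation"
  assumes fol: "is_foliation A F"
    and f: "f \<in> fol_charts F" "x \<in> dom_chart f"
    and f': "f' \<in> fol_charts F" "x \<in> dom_chart f'"
    and diff: "diff_transition_at f f' x"
    and a: "a \<in> span (leaf_dirs F)"
  shows "transition_deriv f f' x a \<in> span (leaf_dirs F)"
proof -
  have L: "leaf_dirs F \<subseteq> Basis"
    and chart: "is_chart f" "is_chart f'"
    using fol f f' unfolding is_foliation_def by auto
  obtain W where W: "open W" "x \<in> W" "W \<subseteq> dom_chart f \<inter> dom_chart f'"
    and plaques: "\<And>y z. y \<in> W \<Longrightarrow> z \<in> W \<Longrightarrow> same_plaque F f y z \<Longrightarrow> same_plaque F f' y z"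
    using fol f f' unfolding is_foliation_def by (metis IntI)
  let ?line = "\<lambda>t::real. coord f x + t *\<^sub>R a"
  define I where "I = ?line -` (coord f ` W)"
  have "open (coord f ` W)"
    using W chart by (intro open_coord_image) auto
  then have I: "open I" "0 \<in> I"
    unfolding I_def using W by (auto intro!: open_vimage continuous_intros)
  have "transition_deriv f f' x a \<bullet> i = 0" if i: "i \<in> Basis" "i \<notin> leaf_dirs F" for i
  proof -
    have const: "transition f f' (?line t) \<bullet> i = coord f' x \<bullet> i" if "t \<in> I" for t
    proof -
      from that obtain y where y: "y \<in> W" "?line t = coord f y"
        unfolding I_def by auto
      have "a \<bullet> j = 0" if "j \<in> Basis - leaf_dirs F" for j
        using a that span_substd_basis[OF L] by auto
      then have "coord f x \<bullet> j = coord f y \<bullet> j" if "j \<in> Basis - leaf_dirs F" for j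
        using that by (simp flip: y(2) add: inner_add_left)
      then have "same_plaque F f x y"
        using W y by (auto simp: same_plaque_def)
      then have "same_plaque F f' x y"
        using plaques W y by blast
      moreover have "transition f f' (?line t) = coord f' y"
        using W y chart by (simp add: transition_coord subset_iff)
      ultimately show ?thesis
        using i by (simp add: same_plaque_def)
    qed
    have "(transition f f' has_derivative transition_deriv f f' x) (at (?line 0))"
      using transition_has_derivative[OF diff] by simp
    moreover have "(?line has_derivative (\<lambda>t. t *\<^sub>R a)) (at 0)"
      by (auto intro!: derivative_eq_intros)
    ultimately have "((transition f f' \<circ> ?line) has_derivative
        (transition_deriv f f' x \<circ> (\<lambda>t. t *\<^sub>R a))) (at 0)"
      by (intro diff_chain_at)
    then have "((\<lambda>t. transition f f' (?line t) \<bullet> i) has_derivative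
        (\<lambda>t. transition_deriv f f' x (t *\<^sub>R a) \<bullet> i)) (at 0)"
      by (simp add: o_def has_derivative_inner_left)
    then have "((\<lambda>t. coord f' x \<bullet> i) has_derivative
        (\<lambda>t. transition_deriv f f' x (t *\<^sub>R a) \<bullet> i)) (at 0)"
      by (rule has_derivative_transform_within_open[OF _ I]) (rule const)
    moreover have "((\<lambda>t::real. coord f' x \<bullet> i) has_derivative (\<lambda>t. 0)) (at 0)"
      by simp
    ultimately have "(\<lambda>t. transition_deriv f f' x (t *\<^sub>R a) \<bullet> i) = (\<lambda>t. 0)"
      by (rule has_derivative_unique)
    from fun_cong[OF this, of 1] show ?thesis
      by simp
  qed
  then show ?thesis
    using span_substd_basis[OF L] by blast
qed

definition coord_proj :: "'e::euclidean_space set \<Rightarrow> 'e \<Rightarrow> 'e" where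
  "coord_proj L v = (\<Sum>i\<in>L. (v \<bullet> i) *\<^sub>R i)"

lemma bounded_linear_coord_proj: "bounded_linear (coord_proj L)"
  unfolding coord_proj_def
  by (intro bounded_linear_sum bounded_linear_compose[OF bounded_linear_scaleR_left]
        bounded_linear_inner_left)

lemma coord_proj_transverse:
  assumes "L \<subseteq> Basis" "i \<in> Basis - L"
  shows "coord_proj L v \<bullet> i = 0"
proof -
  have "b \<bullet> i = 0" if "b \<in> L" for b
    using assms that by (intro inner_not_same_Basis) auto
  then show ?thesis
    by (simp add: coord_proj_def inner_sum_left)
qed

lemma coord_proj_span:
  assumes "L \<subseteq> Basis" "v \<in> span L"
  shows "coord_proj L v = v"
proof -
  have "v = (\<Sum>i\<in>Basis. (v \<bullet> i) *\<^sub>R i)"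
    by (simp add: euclidean_representation)
  also have "\<dots> = (\<Sum>i\<in>L. (v \<bullet> i) *\<^sub>R i)"
    using assms span_substd_basis[OF assms(1)] by (intro sum.mono_neutral_right) auto
  finally show ?thesis
    by (simp add: coord_proj_def)
qed

section \<open>Complementary foliations\<close>

text \<open>Complementarity, read in the coordinates of one chart of each foliation. A coordinate vector
  \<open>u\<close> extends to a tangent vector, and complementarity splits that vector by means of
  foliated charts \<open>f'\<close> and \<open>g'\<close> that depend on \<open>u\<close>; these are then exchanged
  for \<open>f\<close> and \<open>g\<close>.\<close>

lemma complementary_in_coords:
  fixes A :: "('m::{t2_space, second_countable_topology}, 'e::euclidean_space) chart set"
  assumes atlas: "smooth_atlas A" and H: "is_foliation A H" and V: "is_foliation A V"
    and comp: "complementary A H V"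
    and f: "f \<in> fol_charts H" "x \<in> dom_chart f"
    and g: "g \<in> fol_charts V" "x \<in> dom_chart g"
  obtains a b where "a \<in> span (leaf_dirs H)" "b \<in> span (leaf_dirs V)"
    "u = transition_deriv f g x a + b"
proof -
  have chart: "is_chart c" if "c \<in> A \<union> fol_charts H \<union> fol_charts V" for c
    using that atlas_chart[OF atlas] foliation_chart[OF H] foliation_chart[OF V] by blast
  have compat: "smoothly_compatible c e"
    if "c \<in> A \<union> fol_charts H \<union> fol_charts V" "e \<in> A" for c e
    using that atlas_compatible[OF atlas] foliation_compatible[OF H] foliation_compatible[OF V]
    by blast
  have diff: "diff_transition_at c d x"
    if "c \<in> A \<union> fol_charts H \<union> fol_charts V" "d \<in> A \<union> fol_charts H \<union> fol_charts V"
      "x \<in> dom_chart c" "x \<in> dom_chart d" for c d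
    using that chart compat by (intro diff_transition_at_via_atlas[OF atlas]) auto
  have chain: "transition_deriv d e x (transition_deriv c d x v) = transition_deriv c e x v"
    if "c \<in> A \<union> fol_charts H \<union> fol_charts V" "d \<in> A \<union> fol_charts H \<union> fol_charts V"
      "e \<in> A \<union> fol_charts H \<union> fol_charts V"
      "x \<in> dom_chart c" "x \<in> dom_chart d" "x \<in> dom_chart e" for c d e v
    using that by (intro transition_deriv_comp chart diff)
  define v where "v = (\<lambda>c. if c \<in> A \<and> x \<in> dom_chart c then transition_deriv g c x u else 0)"
  have "v \<in> tangent_space A x"
    unfolding tangent_space_def v_def using g by (auto simp: chain)
  then obtain h w where h: "h \<in> leaf_tangent_space A H x" and w: "w \<in> leaf_tangent_space A V x"
    and vhw: "v = (\<lambda>c. h c + w c)"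
    using comp unfolding complementary_def by blast
  from h obtain f' a where f': "f' \<in> fol_charts H" "x \<in> dom_chart f'"
    and a: "a \<in> span (leaf_dirs H)"
    and h_eq: "\<And>c. c \<in> A \<Longrightarrow> x \<in> dom_chart c \<Longrightarrow> h c = transition_deriv f' c x a"
    unfolding leaf_tangent_space_def by blast
  from w obtain g' b where g': "g' \<in> fol_charts V" "x \<in> dom_chart g'"
    and b: "b \<in> span (leaf_dirs V)"
    and w_eq: "\<And>c. c \<in> A \<Longrightarrow> x \<in> dom_chart c \<Longrightarrow> w c = transition_deriv g' c x b"
    unfolding leaf_tangent_space_def by blast
  obtain c where c: "c \<in> A" "x \<in> dom_chart c"
    using atlas unfolding smooth_atlas_def by blast
  have "transition_deriv g c x u = transition_deriv f' c x a + transition_deriv g' c x b"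
    using fun_cong[OF vhw, of c] c h_eq w_eq by (simp add: v_def)
  moreover have "linear (transition_deriv c g x)"
    using diff[of c g] c g unfolding diff_transition_at_def
    by (auto intro: linear_frechet_derivative)
  ultimately have "transition_deriv c g x (transition_deriv g c x u)
      = transition_deriv c g x (transition_deriv f' c x a)
        + transition_deriv c g x (transition_deriv g' c x b)"
    by (simp add: linear_add)
  then have "u = transition_deriv f' g x a + transition_deriv g' g x b"
    using c g f' g' chart by (simp add: chain transition_deriv_self)
  also have "transition_deriv f' g x a = transition_deriv f g x (transition_deriv f' f x a)"
    using f f' g by (simp add: chain)
  finally show thesis
  proof (rule that[rotated 2])
    show "transition_deriv f' f x a \<in> span (leaf_dirs H)"
      using f f' a by (intro foliated_transition_deriv_in_span[OF H] diff) auto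
    show "transition_deriv g' g x b \<in> span (leaf_dirs V)"
      using g g' b by (intro foliated_transition_deriv_in_span[OF V] diff) auto
  qed
qed

text \<open>The map \<open>\<Psi> (s, t)\<close> below moves from \<open>x\<close> along its horizontal plaque, by the part of \<open>s\<close> in the
  horizontal leaf directions, then along a vertical plaque, by the part of \<open>t\<close> in the vertical leaf
  directions, and gives the \<open>g\<close>-coordinates of the end point. Its derivative at the origin is
  surjective by complementarity.\<close>

lemma complementary_saturation_nhd:
  fixes A :: "('m::{t2_space, second_countable_topology}, 'e::euclidean_space) chart set"
  assumes atlas: "smooth_atlas A" and H: "is_foliation A H" and V: "is_foliation A V"
    and comp: "complementary A H V"
  obtains U where "open U" "x \<in> U" "U \<subseteq> saturation V (saturation H {x})"
proof -
  obtain f where f: "f \<in> fol_charts H" "x \<in> dom_chart f"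
    using H unfolding is_foliation_def by blast
  obtain g where g: "g \<in> fol_charts V" "x \<in> dom_chart g"
    using V unfolding is_foliation_def by blast
  have LH: "leaf_dirs H \<subseteq> Basis" and LV: "leaf_dirs V \<subseteq> Basis"
    using H V unfolding is_foliation_def by auto
  have chart: "is_chart f" "is_chart g"
    using f g foliation_chart[OF H] foliation_chart[OF V] by auto
  have diff: "diff_transition_at f g x"
    using f g chart foliation_compatible[OF H] foliation_compatible[OF V]
    by (intro diff_transition_at_via_atlas[OF atlas]) auto
  let ?PH = "coord_proj (leaf_dirs H)" and ?PV = "coord_proj (leaf_dirs V)"
  let ?D = "transition_deriv f g x"
  let ?O = "coord f ` (dom_chart f \<inter> dom_chart g)"
  define \<Psi> where "\<Psi> = (\<lambda>z :: 'e \<times> 'e. transition f g (coord f x + ?PH (fst z)) + ?PV (snd z))"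
  define \<Psi>' where "\<Psi>' = (\<lambda>z :: 'e \<times> 'e. ?D (?PH (fst z)) + ?PV (snd z))"
  define S where "S = (\<lambda>z :: 'e \<times> 'e. coord f x + ?PH (fst z)) -` ?O"
  have proj0: "?PH 0 = 0" "?PV 0 = 0"
    by (simp_all add: coord_proj_def)
  have "open (dom_chart f \<inter> dom_chart g)"
    using chart by (auto simp: is_chart_def)
  then have "open ?O"
    using chart by (intro open_coord_image) auto
  have cont_proj: "continuous_on T (\<lambda>z. coord_proj L (k z))"
    if "continuous_on T k" for T L and k :: "'e \<times> 'e \<Rightarrow> 'e"
    using that by (rule bounded_linear.continuous_on[OF bounded_linear_coord_proj])
  have "open S"
    unfolding S_def by (intro open_vimage \<open>open ?O\<close> continuous_intros cont_proj)
  have "(0, 0) \<in> S"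
    using f g by (simp add: S_def proj0)
  have "continuous_on S (\<lambda>z. transition f g (coord f x + ?PH (fst z)))"
  proof (rule continuous_on_compose2[OF continuous_on_transition[OF chart]])
    show "continuous_on S (\<lambda>z. coord f x + ?PH (fst z))"
      by (intro continuous_intros cont_proj)
  qed (auto simp: S_def)
  then have cont: "continuous_on S \<Psi>"
    unfolding \<Psi>_def by (intro continuous_intros cont_proj)
  have deriv: "(\<Psi> has_derivative \<Psi>') (at (0, 0))"
  proof -
    have "((\<lambda>z. coord f x + ?PH (fst z)) has_derivative (\<lambda>z. ?PH (fst z)))
        (at (0::'e, 0::'e))"
      by (auto intro!: derivative_eq_intros
          bounded_linear.has_derivative[OF bounded_linear_coord_proj])
    moreover have "(transition f g has_derivative ?D)
        (at ((\<lambda>z. coord f x + ?PH (fst z)) (0::'e, 0::'e)))"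
      using transition_has_derivative[OF diff] by (simp add: proj0)
    ultimately have "((transition f g \<circ> (\<lambda>z. coord f x + ?PH (fst z)))
        has_derivative (?D \<circ> (\<lambda>z. ?PH (fst z)))) (at (0::'e, 0::'e))"
      by (rule diff_chain_at)
    then show ?thesis
      unfolding \<Psi>_def \<Psi>'_def o_def
      by (intro has_derivative_add bounded_linear.has_derivative[OF bounded_linear_coord_proj]
          has_derivative_snd has_derivative_ident)
  qed
  have "surj \<Psi>'"
    unfolding surj_def
  proof
    fix u
    obtain a b where "a \<in> span (leaf_dirs H)" "b \<in> span (leaf_dirs V)" "u = ?D a + b"
      using complementary_in_coords[OF assms f g] by blast
    then have "u = \<Psi>' (a, b)"
      by (simp add: \<Psi>'_def coord_proj_span LH LV)
    then show "\<exists>z. u = \<Psi>' z"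
      by blast
  qed
  then obtain g' where g': "linear g'" "\<Psi>' \<circ> g' = id"
    using linear_surjective_right_inverse[OF has_derivative_linear[OF deriv]] by blast
  have nhd: "\<Psi> (0, 0) \<in> interior (\<Psi> ` S)"
    using \<open>open S\<close> \<open>(0, 0) \<in> S\<close> g'
    by (intro sussmann_open_mapping[OF \<open>open S\<close> cont _ deriv, of g'])
      (auto simp: interior_open linear_conv_bounded_linear)
  define U where "U = dom_chart g \<inter> coord g -` interior (\<Psi> ` S)"
  show thesis
  proof
    have "continuous_on (dom_chart g) (coord g)" "open (dom_chart g)"
      using chart(2) unfolding is_chart_def homeomorphism_def by auto
    then show "open U"
      unfolding U_def by (intro continuous_open_preimage open_interior)
    show "x \<in> U"
      using nhd f g chart by (simp add: U_def \<Psi>_def proj0 transition_coord)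
    show "U \<subseteq> saturation V (saturation H {x})"
    proof
      fix z assume "z \<in> U"
      then obtain s t where st: "(s, t) \<in> S" "coord g z = \<Psi> (s, t)" and z: "z \<in> dom_chart g"
        unfolding U_def using interior_subset by fastforce
      from st(1) obtain y where y: "y \<in> dom_chart f" "y \<in> dom_chart g"
        "coord f x + ?PH s = coord f y"
        unfolding S_def by auto
      have "coord f x \<bullet> i = coord f y \<bullet> i" if "i \<in> Basis - leaf_dirs H" for i
        using coord_proj_transverse[OF LH that] by (simp flip: y(3) add: inner_add_left)
      then have "same_plaque H f x y"
        using f y by (simp add: same_plaque_def)
      with f(1) have xy: "y \<in> leaf H x"
        by (rule same_plaque_imp_leaf)
      have "coord g z = coord g y + ?PV t"
        using st y chart by (simp add: \<Psi>_def transition_coord)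
      then have "same_plaque V g y z"
        using y z coord_proj_transverse[OF LV] by (simp add: same_plaque_def inner_add_left)
      with g(1) have "z \<in> leaf V y"
        by (rule same_plaque_imp_leaf)
      with xy show "z \<in> saturation V (saturation H {x})"
        unfolding saturation_def by blast
    qed
  qed
qed

lemma bisaturated_open:
  fixes A :: "('m::{t2_space, second_countable_topology}, 'e::euclidean_space) chart set"
  assumes "smooth_atlas A" "is_foliation A H" "is_foliation A V" "complementary A H V"
    and "saturation H S = S" "saturation V S = S"
  shows "open S"
proof (subst open_subopen, rule ballI)
  fix x assume "x \<in> S"
  then have "saturation V (saturation H {x}) \<subseteq> S"
    using saturation_mono assms(5,6) by (metis empty_subsetI insert_subset)
  moreover obtain U where "open U" "x \<in> U" "U \<subseteq> saturation V (saturation H {x})"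
    using complementary_saturation_nhd[OF assms(1-4)] by blast
  ultimately show "\<exists>T. open T \<and> x \<in> T \<and> T \<subseteq> S"
    by blast
qed

lemma bisaturated_eq_UNIV:
  fixes A :: "('m::{t2_space, second_countable_topology}, 'e::euclidean_space) chart set"
  assumes "smooth_atlas A" "is_foliation A H" "is_foliation A V" "complementary A H V"
    and "connected (UNIV :: 'm set)"
    and "saturation H S = S" "saturation V S = S" "S \<noteq> {}"
  shows "S = UNIV"
proof -
  have "open S" "open (- S)"
    using assms(6,7) by (intro bisaturated_open[OF assms(1-4)] saturation_Compl; simp)+
  with assms(5,8) show ?thesis
    using connectedD[OF assms(5), of S "- S"] by auto
qed

section \<open>The index of attainability\<close>

lemma attainability_index_le:
  assumes "k \<ge> 1" "attainable H V k p = UNIV"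
  shows "attainability_index p H V \<le> enat k"
  using assms by (auto simp: attainability_index_def intro: Least_le)

lemma attainability_index_eq:
  assumes "k \<ge> 1" "attainable H V k p = UNIV"
    and "\<And>j. 1 \<le> j \<Longrightarrow> j < k \<Longrightarrow> attainable H V j p \<noteq> UNIV"
  shows "attainability_index p H V = enat k"
proof -
  have "(LEAST k. k \<ge> 1 \<and> attainable H V k p = UNIV) = k"
    using assms by (intro Least_equality) (auto simp: not_less[symmetric])
  with assms(1,2) show ?thesis
    by (auto simp: attainability_index_def)
qed

theorem proposition4p6:
  fixes A :: "('m::{t2_space, second_countable_topology}, 'e::euclidean_space) chart set"
    and H V :: "('m, 'e) foliation"
    and p :: 'm and k :: nat
  assumes "smooth_atlas A"
    and "connected (UNIV :: 'm set)"
    and "is_foliation A H" and "is_foliation A V"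
    and "complementary A H V"
    and "k \<ge> 1"
    and "attainable H V k p = ((saturation V \<circ> saturation H) ^^ k) {p}"
  shows "attainable H V k p = UNIV \<and>
    co_attainable H V k p = UNIV \<and>
    attainability_index p H V \<le> enat k \<and>
    ((\<forall>j. 1 \<le> j \<and> j < k \<longrightarrow> attainable H V j p \<noteq> UNIV) \<longrightarrow>
       attainability_index p H V = enat k) \<and>
    (attainability_index p H V = enat k \<longrightarrow>
       co_attainable H V (the_enat (attainability_index p H V)) p = UNIV)"
proof -
  let ?S = "attainable H V k p"
  have S: "?S = UNIV"
  proof (rule bisaturated_eq_UNIV[OF assms(1,3,4,5,2)])
    show "saturation H ?S = ?S"
      unfolding attainable_def by (rule saturation_saturations_pow[OF \<open>k \<ge> 1\<close>])
    show "saturation V ?S = ?S"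
      unfolding assms(7) by (rule saturation_saturations_pow[OF \<open>k \<ge> 1\<close>])
    show "?S \<noteq> {}"
      unfolding attainable_def using saturations_pow_superset[of "{p}"] by blast
  qed
  then have C: "co_attainable H V k p = UNIV"
    using assms(7) by (simp add: co_attainable_def attainable_def)
  show ?thesis
    using S C attainability_index_le[OF \<open>k \<ge> 1\<close> S] attainability_index_eq[OF \<open>k \<ge> 1\<close> S]
    by auto
qed

end
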